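(* Let $1\le K\le D$, let $\Sigma=[\sigma_1|\cdots|\sigma_K]\in\mathbb{R}^{D\times K}$ have affinely independent columns, and let $\rho_\Sigma:\mathbb{R}^D\to\Delta_K$ be the projection onto barycentric coordinates. Let $A\subset H:=\mathbb{R}^D$ be a compact set with upper box-counting dimension $d_{box}$ and thickness exponent $\sigma$, let $f:H\to H$ be Lipschitz with $f(A)=A$ and $f|_A:A\to A$ invertible, and consider the discrete-time dynamical system $x_t=f(x_{t-1})$ on $A$. Let $M\in\mathbb{N}$ satisfy $M>2(d_{box}+\sigma)$, and suppose that the set $A_M$ of $M$-periodic points of $f$ in $A$ satisfies $d_{box}(A_M)<M/(2+\sigma)$. Assume that $\rho_\Sigma$ belongs to the set $\mathcal{G}_M$ of Lipschitz maps singled out by the delay embedding theorem. Then there exists a map $\mathbf{v}$, defined on the set of path affiliation vectors $\{\Psi^M(\rho_\Sigma(x),\rho_\Sigma(f^{-1}(x)),\dots,\rho_\Sigma(f^{-M+1}(x))):x\in A\}$ and with values in $\Delta_K$, such that for all $x_{t-M},\dots,x_{t-1},x_t\in A$ with $x_s=f(x_{s-1})$ for $s=t-M+1,\dots,t$, writing $\gamma_s:=\rho_\Sigma(x_s)$ and $\psi^M_{t-1}:=\Psi^M(\gamma_{t-1},\dots,\gamma_{t-M})$, one has $$\mathbf{v}(\psi^M_{t-1})=\rho_\Sigma(f(x_{t-1}))=\gamma_t .$$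
   Context: $\Delta_K=\{\gamma\in\mathbb{R}^K:\gamma^i\ge 0,\ \sum_{i=1}^K\gamma^i=1\}$ is the set of barycentric coordinates. For $\Sigma$ with affinely independent columns, $\rho_\Sigma(x):=\arg\min_{\gamma\in\Delta_K}\|x-\Sigma\gamma\|_2$ (the minimizer is unique), so $\Sigma\rho_\Sigma(x)$ is the orthogonal projection of $x$ onto the simplex $\mathrm{conv}(\sigma_1,\dots,\sigma_K)$. Path affiliation function: $\Psi^M:(\Delta_K)^M\to\mathbb{R}^{K^M}$ is given by $\Psi^M(\gamma_1,\dots,\gamma_M)_i=\gamma_1^{i_1}\gamma_2^{i_2}\cdots\gamma_M^{i_M}$ with $J(i)=[i_1,\dots,i_M]$, where $J:\{1,\dots,K^M\}\to\{1,\dots,K\}^M$ is a fixed bijection. The thickness exponent of $A$ in $H$ is $\limsup_{n\to\infty}\frac{-\log n}{\log\varepsilon_H(A,n)}$, where $\varepsilon_H(A,n)$ is the minimal distance $\min_V\sup_{a\in A}\mathrm{dist}(a,V)$ over $n$-dimensional linear subspaces $V$ of $H$ (interpreted as $0$ if $\varepsilon_H(A,n)=0$ for large $n$). The powers $f^{-j}$ refer to the inverse of $f|_A$. The delay embedding theorem for Lipschitz maps (Robinson; in its version for vector-valued observables) states that, if $A\subset H$ is compact with upper box-counting dimension $d_{box}$ and thickness exponent $\sigma$, $f:H\to H$ is Lipschitz with $f(A)=A$ and $f|_A$ invertible, $M>2(d_{box}+\sigma)$, and the set $A_M$ of $M$-periodic points of $f$ in $A$ satisfies $d_{box}(A_M)<M/(2+\sigma)$,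 then a prevalent set of Lipschitz maps $g$ on $H$ (here with values in $\mathbb{R}^K$) makes the $M$-fold observation map $x\mapsto(g(x),g(f^{-1}(x)),\dots,g(f^{-M+1}(x)))$ injective on $A$. $\mathcal{G}_M$ denotes the set of Lipschitz maps $g:H\to\mathbb{R}^K$ for which this observation map is injective on $A$. *)

theory Defs
  imports "HOL-Analysis.Analysis"
begin

definition bary_simplex :: "(real ^ 'k) set"
  where "bary_simplex = {\<gamma>. (\<forall>i. 0 \<le> \<gamma> $ i) \<and> (\<Sum>i\<in>UNIV. \<gamma> $ i) = 1}"

text \<open>Affine independence of the \<^emph>\<open>family\<close> of columns: \<^const>\<open>affine_dependent\<close> concerns sets, so
  injectivity is needed to rule out repeated columns.\<close>

definition affinely_independent_columns :: "real ^ 'k ^ 'd \<Rightarrow> bool"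
  where "affinely_independent_columns S \<longleftrightarrow>
    inj (\<lambda>k. column k S) \<and> \<not> affine_dependent (range (\<lambda>k. column k S))"

text \<open>The minimiser is unique if the columns of \<open>S\<close> are affinely independent.\<close>

definition bary_proj :: "real ^ 'k ^ 'd \<Rightarrow> real ^ 'd \<Rightarrow> real ^ 'k"
  where "bary_proj S x = arg_min_on (\<lambda>\<gamma>. norm (x - S *v \<gamma>)) bary_simplex"

text \<open>A point of \<open>\<real>\<close> to the power \<open>K^M\<close> is an extensional function on \<open>{1..K^M}\<close>, and a path
  \<open>(\<gamma>\<^sub>1, \<dots>, \<gamma>\<^sub>M)\<close> is a function on \<open>{1..M}\<close>. The intended enumerations \<open>J\<close> of the multi-indices
  are the bijections from \<open>{1..K^M}\<close> onto \<open>{1..M} \<rightarrow>\<^sub>E UNIV\<close>.\<close>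

definition path_affiliation ::
    "(nat \<Rightarrow> nat \<Rightarrow> 'k) \<Rightarrow> nat \<Rightarrow> (nat \<Rightarrow> real ^ 'k) \<Rightarrow> (nat \<Rightarrow> real)"
  where "path_affiliation J M \<gamma> = (\<lambda>i\<in>{1..CARD('k) ^ M}. \<Prod>j=1..M. \<gamma> j $ J i j)"

text \<open>Meaningful for totally bounded \<open>A\<close>, where finite covers exist.\<close>

definition covering_number :: "'a::metric_space set \<Rightarrow> real \<Rightarrow> nat"
  where "covering_number A \<epsilon> =
    (LEAST n. \<exists>C. finite C \<and> card C = n \<and> A \<subseteq> (\<Union>c\<in>C. cball c \<epsilon>))"

text \<open>Since \<open>ln 0 = 0\<close>, the empty set has dimension \<open>0\<close>.\<close>

definition upper_box_dim :: "'a::metric_space set \<Rightarrow> ereal"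
  where "upper_box_dim A =
    Limsup (at_right 0) (\<lambda>\<epsilon>. ereal (ln (real (covering_number A \<epsilon>)) / (- ln \<epsilon>)))"

text \<open>For \<open>n\<close> above the dimension of the space, where there are no \<open>n\<close>-dimensional subspaces, \<open>V\<close>
  is the whole space and the distance is \<open>0\<close>.\<close>

definition subspace_approx_error :: "'a::euclidean_space set \<Rightarrow> nat \<Rightarrow> ennreal"
  where "subspace_approx_error A n =
    (INF V\<in>{V. subspace V \<and> dim V = min n DIM('a)}. SUP a\<in>A. ennreal (infdist a V))"

definition thickness_exponent :: "'a::euclidean_space set \<Rightarrow> ereal"
  where "thickness_exponent A =
    (if \<forall>\<^sub>F n in sequentially. subspace_approx_error A n = 0 then 0
     else Limsup sequentially
       (\<lambda>n. ereal (- ln (real n) / ln (enn2real (subspace_approx_error A n)))))"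

definition periodic_points :: "('a \<Rightarrow> 'a) \<Rightarrow> 'a set \<Rightarrow> nat \<Rightarrow> 'a set"
  where "periodic_points f A M = {x \<in> A. (f ^^ M) x = x}"

definition back_orbit :: "('a \<Rightarrow> 'a) \<Rightarrow> 'a set \<Rightarrow> nat \<Rightarrow> 'a \<Rightarrow> 'a"
  where "back_orbit f A j x = (inv_into A f ^^ j) x"

definition observation_map ::
    "('a \<Rightarrow> 'a) \<Rightarrow> 'a set \<Rightarrow> nat \<Rightarrow> ('a \<Rightarrow> 'b) \<Rightarrow> 'a \<Rightarrow> (nat \<Rightarrow> 'b)"
  where "observation_map f A M g x = (\<lambda>j\<in>{1..M}. g (back_orbit f A (j - 1) x))"

text \<open>The set \<open>\<G>\<^sub>M\<close> of admissible observables.\<close>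

definition delay_observables ::
    "('a::metric_space \<Rightarrow> 'a) \<Rightarrow> 'a set \<Rightarrow> nat \<Rightarrow> ('a \<Rightarrow> 'b::metric_space) set"
  where "delay_observables f A M =
    {g. (\<exists>L. L-lipschitz_on UNIV g) \<and> inj_on (observation_map f A M g) A}"

end

theory Submission imports Defs begin

text \<open>A path affiliation vector is the joint mass function of a product of probability vectors, so
  its marginals recover the factors; hence \<open>\<Psi>\<^sup>M\<close> is injective. Together with the
  injectivity of the delay map this determines \<open>x\<^sub>t\<^sub>-\<^sub>1\<close>, and with it \<open>\<gamma>\<^sub>t\<close>, from the path affiliation
  vector. The bound on the dimension enters through \<open>M > 0\<close>, which puts \<open>x\<^sub>t\<^sub>-\<^sub>1\<close> into \<open>A\<close>.\<close>

lemma compact_bary_simplex: "compact (bary_simplex :: (real ^ 'k) set)"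
proof -
  have "closed {\<gamma> :: real ^ 'k. \<forall>i. 0 \<le> \<gamma> $ i}"
    by (intro closed_Collect_all closed_Collect_le continuous_intros)
  moreover have "closed {\<gamma> :: real ^ 'k. (\<Sum>i\<in>UNIV. \<gamma> $ i) = 1}"
    by (intro closed_Collect_eq continuous_intros)
  ultimately have "closed (bary_simplex :: (real ^ 'k) set)"
    unfolding bary_simplex_def by (rule closed_Collect_conj)
  moreover have "norm \<gamma> \<le> 1" if "\<gamma> \<in> bary_simplex" for \<gamma> :: "real ^ 'k"
    using norm_le_l1_cart[of \<gamma>] that by (simp add: bary_simplex_def)
  then have "bounded (bary_simplex :: (real ^ 'k) set)"
    by (auto simp: bounded_iff)
  ultimately show ?thesis
    by (simp add: compact_eq_bounded_closed)
qed

lemma bary_simplex_nonempty: "(bary_simplex :: (real ^ 'k) set) \<noteq> {}"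
proof -
  have "axis k 1 \<in> (bary_simplex :: (real ^ 'k) set)" for k
    by (auto simp: bary_simplex_def axis_def)
  then show ?thesis by blast
qed

text \<open>\<open>arg_min_on\<close> is a Hilbert choice, so membership rests on the existence of a
  minimiser: a continuous function attains its infimum on the compact nonempty simplex.\<close>

lemma bary_proj_in_bary_simplex: "bary_proj S x \<in> bary_simplex"
proof -
  have "continuous_on bary_simplex (\<lambda>\<gamma>. norm (x - S *v \<gamma>))"
    by (intro continuous_intros linear_continuous_on) simp
  then have "\<exists>\<gamma>\<in>bary_simplex. \<forall>\<gamma>'\<in>bary_simplex. norm (x - S *v \<gamma>) \<le> norm (x - S *v \<gamma>')"
    by (rule continuous_attains_inf[OF compact_bary_simplex bary_simplex_nonempty])
  then obtain \<gamma> where "is_arg_min (\<lambda>\<gamma>. norm (x - S *v \<gamma>)) (\<lambda>\<gamma>. \<gamma> \<in> bary_simplex) \<gamma>"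
    unfolding is_arg_min_linorder by blast
  then have "is_arg_min (\<lambda>\<gamma>. norm (x - S *v \<gamma>)) (\<lambda>\<gamma>. \<gamma> \<in> bary_simplex) (bary_proj S x)"
    unfolding bary_proj_def arg_min_on_def arg_min_def by (rule someI)
  then show ?thesis by (simp add: is_arg_min_def)
qed

text \<open>A sum of products over a product of index sets is the product of the sums. With
  coordinate \<open>m\<close> pinned to \<open>k\<close>, the sums over the other coordinates are
  total masses, equal to 1, and only \<open>\<gamma> m $ k\<close> remains.\<close>

lemma path_affiliation_marginal:
  fixes \<gamma> :: "nat \<Rightarrow> real ^ 'k"
  assumes J: "bij_betw J {1..CARD('k) ^ M} ({1..M} \<rightarrow>\<^sub>E (UNIV :: 'k set))"
    and \<gamma>: "\<And>j. j \<in> {1..M} \<Longrightarrow> \<gamma> j \<in> bary_simplex"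
    and m: "m \<in> {1..M}"
  shows "(\<Sum>i | i \<in> {1..CARD('k) ^ M} \<and> J i m = k. path_affiliation J M \<gamma> i) = \<gamma> m $ k"
proof -
  let ?I = "{i. i \<in> {1..CARD('k) ^ M} \<and> J i m = k}"
  \<comment> \<open>Writing the constraint \<open>g m = k\<close> as a singleton factor keeps the
    index set a full product, as the interchange of sum and product requires.\<close>
  let ?B = "\<lambda>j. if j = m then {k} else (UNIV :: 'k set)"
  have PiE: "PiE {1..M} ?B = {g \<in> {1..M} \<rightarrow>\<^sub>E UNIV. g m = k}"
    using m by (auto simp: PiE_iff extensional_def split: if_splits)
  have "bij_betw J ?I (PiE {1..M} ?B)"
  proof (rule bij_betw_subset[OF J])
    show "J ` ?I = PiE {1..M} ?B"
      unfolding PiE bij_betw_imp_surj_on[OF J, symmetric] by blast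
  qed blast
  then have "(\<Sum>i\<in>?I. \<Prod>j=1..M. \<gamma> j $ J i j) = (\<Sum>g\<in>PiE {1..M} ?B. \<Prod>j=1..M. \<gamma> j $ g j)"
    by (rule sum.reindex_bij_betw)
  also have "\<dots> = (\<Prod>j=1..M. \<Sum>l\<in>?B j. \<gamma> j $ l)"
    by (rule prod_sum_PiE[symmetric]) auto
  also have "\<dots> = (\<Prod>j=1..M. if j = m then \<gamma> m $ k else 1)"
    using \<gamma> by (intro prod.cong) (auto simp: bary_simplex_def)
  also have "\<dots> = \<gamma> m $ k"
    using m by simp
  finally show ?thesis
    by (simp add: path_affiliation_def)
qed

lemma path_affiliation_inject:
  fixes \<gamma> \<gamma>' :: "nat \<Rightarrow> real ^ 'k"
  assumes "bij_betw J {1..CARD('k) ^ M} ({1..M} \<rightarrow>\<^sub>E (UNIV :: 'k set))"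
    and "\<And>j. j \<in> {1..M} \<Longrightarrow> \<gamma> j \<in> bary_simplex"
    and "\<And>j. j \<in> {1..M} \<Longrightarrow> \<gamma>' j \<in> bary_simplex"
    and "path_affiliation J M \<gamma> = path_affiliation J M \<gamma>'"
    and "j \<in> {1..M}"
  shows "\<gamma> j = \<gamma>' j"
  using path_affiliation_marginal[of J M \<gamma> j] path_affiliation_marginal[of J M \<gamma>' j] assms
  by (simp add: vec_eq_iff)

lemma path_affiliation_cong:
  assumes "\<And>j. j \<in> {1..M} \<Longrightarrow> \<gamma> j = \<gamma>' j"
  shows "path_affiliation J M \<gamma> = path_affiliation J M \<gamma>'"
  unfolding path_affiliation_def by (intro restrict_ext prod.cong) (use assms in auto)

text \<open>The sequence \<open>y\<close> runs backwards in time, with \<open>y j\<close> lying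
  \<open>j\<close> steps before \<open>y 0\<close>. Injectivity on \<open>A\<close> lets
  \<open>inv_into A f\<close> undo one application of \<open>f\<close> at each step.\<close>

lemma back_orbit_eq:
  assumes "inj_on f A"
    and "\<And>j. j \<le> n \<Longrightarrow> y j \<in> A"
    and "\<And>j. j < n \<Longrightarrow> y j = f (y (Suc j))"
  shows "back_orbit f A n (y 0) = y n"
  using assms(2,3)
proof (induction n)
  case 0
  show ?case by (simp add: back_orbit_def)
next
  case (Suc n)
  have "back_orbit f A (Suc n) (y 0) = inv_into A f (back_orbit f A n (y 0))"
    by (simp add: back_orbit_def)
  also have "back_orbit f A n (y 0) = f (y (Suc n))"
    using Suc.IH Suc.prems by (metis le_SucI less_SucI lessI)
  also have "inv_into A f (f (y (Suc n))) = y (Suc n)"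
    using Suc.prems(1) by (simp add: inv_into_f_f[OF assms(1)])
  finally show ?case .
qed

text \<open>For scales below 1 the denominator is positive, and the logarithm of a natural number is
  never negative, with \<open>ln 0 = 0\<close> covering the value 0.\<close>

lemma upper_box_dim_nonneg: "0 \<le> upper_box_dim A"
proof -
  have "0 \<le> ln (real (covering_number A \<epsilon>)) / (- ln \<epsilon>)" if "0 < \<epsilon>" "\<epsilon> < 1" for \<epsilon>
  proof -
    have "0 \<le> ln (real n)" for n
      by (cases n) auto
    then show ?thesis
      using that by (intro divide_nonneg_nonneg) auto
  qed
  then have "\<forall>\<^sub>F \<epsilon> in at_right 0. 0 \<le> ereal (ln (real (covering_number A \<epsilon>)) / (- ln \<epsilon>))"
    using eventually_at_right_real[of 0 1] by (auto elim!: eventually_mono)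
  then show ?thesis
    unfolding upper_box_dim_def by (intro le_Limsup) auto
qed

text \<open>Once \<open>n\<close> reaches the dimension of the space, the whole space is an
  admissible \<open>V\<close> and the error vanishes, so the first branch of the definition
  applies.\<close>

lemma thickness_exponent_eq_0: "thickness_exponent (A :: 'a::euclidean_space set) = 0"
proof -
  have "subspace_approx_error A n = 0" if "DIM('a) \<le> n" for n
  proof -
    have "subspace_approx_error A n \<le> (SUP a\<in>A. ennreal (infdist a UNIV))"
      unfolding subspace_approx_error_def by (rule INF_lower) (use that in simp)
    also have "\<dots> \<le> 0"
      by (intro SUP_least) simp
    finally show ?thesis by simp
  qed
  then have "\<forall>\<^sub>F n in sequentially. subspace_approx_error A n = 0"
    by (rule eventually_sequentiallyI)
  then show ?thesis by (simp add: thickness_exponent_def)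
qed

theorem theorem3p10:
  fixes S :: "real ^ 'k ^ 'd"
    and A :: "(real ^ 'd) set"
    and f :: "real ^ 'd \<Rightarrow> real ^ 'd"
    and M :: nat
    and J :: "nat \<Rightarrow> nat \<Rightarrow> 'k"
  assumes "CARD('k) \<le> CARD('d)"
    and "affinely_independent_columns S"
    and "bij_betw J {1..CARD('k) ^ M} ({1..M} \<rightarrow>\<^sub>E (UNIV :: 'k set))"
    and "compact A"
    and "\<exists>L. L-lipschitz_on UNIV f"
    and "f ` A = A"
    and "inj_on f A"
    and "2 * (upper_box_dim A + thickness_exponent A) < ereal (real M)"
    and "upper_box_dim (periodic_points f A M) < ereal (real M) / (2 + thickness_exponent A)"
    and "bary_proj S \<in> delay_observables f A M"
  shows "\<exists>v :: (nat \<Rightarrow> real) \<Rightarrow> real ^ 'k.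
    v \<in> {path_affiliation J M (\<lambda>j. bary_proj S (back_orbit f A (j - 1) x)) | x. x \<in> A}
          \<rightarrow> bary_simplex \<and>
    (\<forall>(x :: int \<Rightarrow> real ^ 'd) (t :: int).
       (\<forall>s\<in>{t - int M..t}. x s \<in> A) \<longrightarrow>
       (\<forall>s\<in>{t - int M + 1..t}. x s = f (x (s - 1))) \<longrightarrow>
       v (path_affiliation J M (\<lambda>j. bary_proj S (x (t - int j)))) = bary_proj S (f (x (t - 1))) \<and>
       bary_proj S (f (x (t - 1))) = bary_proj S (x t))"
proof -
  let ?\<Psi> = "\<lambda>x. path_affiliation J M (\<lambda>j. bary_proj S (back_orbit f A (j - 1) x))"
  have "0 \<le> 2 * (upper_box_dim A + thickness_exponent A)"
    by (simp add: upper_box_dim_nonneg thickness_exponent_eq_0)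
  then have "0 < ereal (real M)"
    using assms(8) by (rule le_less_trans)
  then have M: "0 < M" by simp
  have "inj_on (observation_map f A M (bary_proj S)) A"
    using assms(10) by (simp add: delay_observables_def)
  \<comment> \<open>The observations along the backward orbit are exactly the factors of the path
    affiliation vector, so equal vectors force equal observations.\<close>
  moreover have "observation_map f A M (bary_proj S) x = observation_map f A M (bary_proj S) y"
    if "?\<Psi> x = ?\<Psi> y" for x y
    unfolding observation_map_def
    by (intro restrict_ext path_affiliation_inject[OF assms(3) _ _ that] bary_proj_in_bary_simplex)
  ultimately have inj: "inj_on ?\<Psi> A"
    unfolding inj_on_def by blast
  \<comment> \<open>Recover the current state from its path affiliation vector, advance it by
    \<open>f\<close>, then project. The outer projection keeps every value in the simplex.\<close>
  define v where "v = (\<lambda>\<psi>. bary_proj S (f (inv_into A ?\<Psi> \<psi>)))"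
  show ?thesis
  proof (intro exI[of _ v] conjI allI impI)
    show "v \<in> {?\<Psi> x | x. x \<in> A} \<rightarrow> bary_simplex"
      by (simp add: v_def bary_proj_in_bary_simplex)
  next
    fix x :: "int \<Rightarrow> real ^ 'd" and t :: int
    assume A: "\<forall>s\<in>{t - int M..t}. x s \<in> A"
      and orbit: "\<forall>s\<in>{t - int M + 1..t}. x s = f (x (s - 1))"
    have "back_orbit f A (j - 1) (x (t - 1)) = x (t - int j)" if "j \<in> {1..M}" for j
    proof -
      have "x (t - 1 - int i) = f (x (t - 1 - int (Suc i)))" if "i < j - 1" for i
      proof -
        \<comment> \<open>Here \<open>i \<le> j - 2 \<le> M - 2\<close>, so the time is at least
          \<open>t - M + 1\<close>, the first one at which the orbit relation is assumed.\<close>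
        have "t - 1 - int i \<in> {t - int M + 1..t}"
          using that \<open>j \<in> {1..M}\<close> by auto
        then show ?thesis
          using orbit by (simp add: algebra_simps)
      qed
      then have "back_orbit f A (j - 1) (x (t - 1 - int 0)) = x (t - 1 - int (j - 1))"
        by (intro back_orbit_eq[where y = "\<lambda>i. x (t - 1 - int i)"] assms(7)) (use A that in auto)
      then show ?thesis using that by (simp add: of_nat_diff)
    qed
    then have "path_affiliation J M (\<lambda>j. bary_proj S (x (t - int j))) = ?\<Psi> (x (t - 1))"
      by (intro path_affiliation_cong) simp
    moreover have "x (t - 1) \<in> A"
      using A M by simp
    ultimately show "v (path_affiliation J M (\<lambda>j. bary_proj S (x (t - int j))))
        = bary_proj S (f (x (t - 1)))"
      unfolding v_def by (simp only: inv_into_f_f[OF inj])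
    \<comment> \<open>For \<open>M > 0\<close> the range \<open>{t - int M + 1..t}\<close> contains
      \<open>t\<close>, so the orbit relation gives the last transition.\<close>
    show "bary_proj S (f (x (t - 1))) = bary_proj S (x t)"
      using orbit M by simp
  qed
qed

end
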